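(* Let $L(q,\dot q)=\tfrac12 g_q(\dot q,\dot q)-V(q)$ be a natural Lagrangian on $Q$ with constraint distribution $\mathcal D=\bigcap_{\alpha=1}^m\ker\eta^\alpha\subset TQ$, let $W^\alpha=\mathbb FL^{-1}\eta^\alpha$, and let $S=h^{-1}(0)\subset Q$ be an impact surface with $dh|_S\notin\mathcal D^0|_S$. Then the nonholonomic impact map $\Delta^{\mathcal D}:\hat S_{\mathcal D}\to\mathcal D$, $(q,\dot q)\mapsto(q,\delta(q,\dot q))$, that is, the nontrivial ($\varepsilon\neq0$) solution $\dot q^-=\dot q\mapsto\dot q^+=\delta(q,\dot q)$ of the nonholonomic corner conditions $$\mathbb FL(\dot q^+)-\mathbb FL(\dot q^-)=\lambda_k\,\eta^k+\varepsilon\,dh,$$ $$L(q,\dot q^+)-\langle\mathbb FL(\dot q^+),\dot q^+\rangle=L(q,\dot q^-)-\langle\mathbb FL(\dot q^-),\dot q^-\rangle,$$ $$\eta^k(\dot q^+)=0\quad(k=1,\dots,m),$$ with multipliers $\lambda_k,\varepsilon\in\mathbb R$, is given by $$\delta(q,\dot q)=\dot q+\lambda_k W^k+\varepsilon\,\nabla h,$$ where $$\varepsilon=\frac{-2\,dh(\dot q)}{dh(\nabla h)-m_{\alpha\beta}\,dh(W^\alpha)\,dh(W^\beta)},\qquad \lambda_k=\frac{2\,m_{k\ell}\,dh(W^\ell)\,dh(\dot q)}{dh(\nabla h)-m_{\alpha\beta}\,dh(W^\alpha)\,dh(W^\beta)}.$$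
   Context: $Q$ is a smooth finite-dimensional manifold, $g$ a Riemannian metric on $Q$, $V:Q\to\mathbb R$ smooth. The fiber derivative is $\mathbb FL:TQ\to T^*Q$, $\mathbb FL(v)=g(v,\cdot)$. $\eta^1,\dots,\eta^m\in\Omega^1(Q)$ are pointwise linearly independent constraint 1-forms, $\mathcal D=\{(q,\dot q):\eta^\alpha_q(\dot q)=0,\ \alpha=1,\dots,m\}$, and $\mathcal D^0\subset T^*Q$ is the annihilator of $\mathcal D$. $W^\alpha=\mathbb FL^{-1}\eta^\alpha$ are the dual vector fields; $m^{\alpha\beta}=\eta^\alpha(W^\beta)=g(W^\alpha,W^\beta)$ and $(m_{\alpha\beta})=(m^{\alpha\beta})^{-1}$. $S\subset Q$ is an embedded codimension 1 submanifold given as the zero level set of a smooth function $h:Q\to\mathbb R$ with $dh\ne0$ on $S$; $\nabla h$ is the $g$-gradient. $\hat S_{\mathcal D}=\{(q,\dot q)\in\mathcal D: h(q)=0,\ dh(\dot q)<0\}$. Superscripts $-$ and $+$ denote values before and after impact; the impact is the identity on the base $Q$. Repeated indices are summed. *)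

theory Defs
  imports "HOL-Analysis.Analysis" "HOL-Library.Function_Algebras"
begin

instantiation "fun" :: (type, real_vector) real_vector
begin

definition scaleR_fun :: "real \<Rightarrow> ('a \<Rightarrow> 'b) \<Rightarrow> 'a \<Rightarrow> 'b"
  where "scaleR_fun r f = (\<lambda>x. r *\<^sub>R f x)"

instance
  by standard (simp_all add: scaleR_fun_def plus_fun_def fun_eq_iff algebra_simps)

end


section \<open>Smooth manifolds\<close>

text \<open>The meaning is the usual one when \<open>S\<close> is open: all iterated directional derivatives
  of order at most \<open>k\<close> exist and are continuous on \<open>S\<close>.\<close>

primrec Ck_on :: "nat \<Rightarrow> 'a::euclidean_space set \<Rightarrow> ('a \<Rightarrow> 'b::real_normed_vector) \<Rightarrow> bool" where
  "Ck_on 0 S f \<longleftrightarrow> continuous_on S f"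
| "Ck_on (Suc k) S f \<longleftrightarrow>
     (\<forall>x\<in>S. f differentiable (at x)) \<and> (\<forall>u. Ck_on k S (\<lambda>x. frechet_derivative f (at x) u))"

definition smooth_on :: "'a::euclidean_space set \<Rightarrow> ('a \<Rightarrow> 'b::real_normed_vector) \<Rightarrow> bool"
  where "smooth_on S f \<longleftrightarrow> (\<forall>k. Ck_on k S f)"

text \<open>A chart is a pair \<open>(U, \<phi>)\<close>; the values of \<open>\<phi>\<close> outside \<open>U\<close> are irrelevant.\<close>

type_synonym ('q, 'e) chart = "'q set \<times> ('q \<Rightarrow> 'e)"

definition chart_inv :: "('q, 'e) chart \<Rightarrow> 'e \<Rightarrow> 'q"
  where "chart_inv c = inv_into (fst c) (snd c)"

definition transition :: "('q, 'e) chart \<Rightarrow> ('q, 'e) chart \<Rightarrow> 'e \<Rightarrow> 'e"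
  where "transition c c' = snd c' \<circ> chart_inv c"

text \<open>The smooth structure is given by an atlas \<open>A\<close>, not necessarily maximal.\<close>

definition smooth_manifold :: "'q topology \<Rightarrow> ('q, 'e::euclidean_space) chart set \<Rightarrow> bool" where
  "smooth_manifold Q A \<longleftrightarrow>
     Hausdorff_space Q \<and> second_countable Q \<and>
     \<Union>(fst ` A) = topspace Q \<and>
     (\<forall>(U, \<phi>)\<in>A. openin Q U \<and> open (\<phi> ` U) \<and>
        homeomorphic_map (subtopology Q U) (top_of_set (\<phi> ` U)) \<phi>) \<and>
     (\<forall>c\<in>A. \<forall>c'\<in>A. smooth_on (snd c ` (fst c \<inter> fst c')) (transition c c'))"

definition smooth_fun :: "('q, 'e::euclidean_space) chart set \<Rightarrow> ('q \<Rightarrow> real) \<Rightarrow> bool"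
  where "smooth_fun A f \<longleftrightarrow> (\<forall>c\<in>A. smooth_on (snd c ` fst c) (f \<circ> chart_inv c))"


section \<open>Tangent and cotangent spaces\<close>

text \<open>A tangent vector at \<open>q\<close> is the family of its coordinate representatives in all charts
  around \<open>q\<close>, which transform by the derivatives of the transition maps. The family is \<open>0\<close> at
  all other indices, so that equality of tangent vectors at \<open>q\<close> is equality of functions.\<close>

type_synonym ('q, 'e) tvec = "('q, 'e) chart \<Rightarrow> 'e"

definition tangent_space ::
  "('q, 'e::euclidean_space) chart set \<Rightarrow> 'q \<Rightarrow> ('q, 'e) tvec set" where
  "tangent_space A q = {v.
     (\<forall>c\<in>A. \<forall>c'\<in>A. q \<in> fst c \<inter> fst c' \<longrightarrow>
        v c' = frechet_derivative (transition c c') (at (snd c q)) (v c)) \<and>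
     (\<forall>c. \<not> (c \<in> A \<and> q \<in> fst c) \<longrightarrow> v c = 0)}"

definition linear_form_on :: "'v::real_vector set \<Rightarrow> ('v \<Rightarrow> real) \<Rightarrow> bool" where
  "linear_form_on T \<alpha> \<longleftrightarrow>
     (\<forall>v\<in>T. \<forall>w\<in>T. \<alpha> (v + w) = \<alpha> v + \<alpha> w) \<and> (\<forall>r. \<forall>v\<in>T. \<alpha> (r *\<^sub>R v) = r * \<alpha> v)"

text \<open>Covectors are \<open>0\<close> outside the tangent space, so that equality of covectors at \<open>q\<close> is
  equality of functions.\<close>

type_synonym ('q, 'e) covec = "('q, 'e) tvec \<Rightarrow> real"

definition cotangent_space ::
  "('q, 'e::euclidean_space) chart set \<Rightarrow> 'q \<Rightarrow> ('q, 'e) covec set" where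
  "cotangent_space A q =
     {\<alpha>. linear_form_on (tangent_space A q) \<alpha> \<and> (\<forall>v. v \<notin> tangent_space A q \<longrightarrow> \<alpha> v = 0)}"

definition tangent_bundle ::
  "'q topology \<Rightarrow> ('q, 'e::euclidean_space) chart set \<Rightarrow> ('q \<times> ('q, 'e) tvec) set"
  where "tangent_bundle Q A = (SIGMA q:topspace Q. tangent_space A q)"

definition cotangent_bundle ::
  "'q topology \<Rightarrow> ('q, 'e::euclidean_space) chart set \<Rightarrow> ('q \<times> ('q, 'e) covec) set"
  where "cotangent_bundle Q A = (SIGMA q:topspace Q. cotangent_space A q)"

text \<open>The tangent vector at \<open>q\<close> whose representative in the chart \<open>c\<close> around \<open>q\<close> is \<open>e\<close>.\<close>

definition coord_vector ::
  "('q, 'e::euclidean_space) chart set \<Rightarrow> ('q, 'e) chart \<Rightarrow> 'e \<Rightarrow> 'q \<Rightarrow> ('q, 'e) tvec" where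
  "coord_vector A c e q =
     (\<lambda>c'. if c' \<in> A \<and> q \<in> fst c' then frechet_derivative (transition c c') (at (snd c q)) e else 0)"

definition smooth_one_form ::
  "('q, 'e::euclidean_space) chart set \<Rightarrow> ('q \<Rightarrow> ('q, 'e) covec) \<Rightarrow> bool" where
  "smooth_one_form A \<omega> \<longleftrightarrow>
     (\<forall>q\<in>\<Union>(fst ` A). \<omega> q \<in> cotangent_space A q) \<and>
     (\<forall>c\<in>A. \<forall>b\<in>Basis. smooth_on (snd c ` fst c) ((\<lambda>q. \<omega> q (coord_vector A c b q)) \<circ> chart_inv c))"

text \<open>The differential is computed in one chart around \<open>q\<close>; by \<open>differential_eq\<close> below
  any other chart gives the same value.\<close>

definition differential ::
  "('q, 'e::euclidean_space) chart set \<Rightarrow> ('q \<Rightarrow> real) \<Rightarrow> 'q \<Rightarrow> ('q, 'e) covec" where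
  "differential A f q = (\<lambda>v. if v \<in> tangent_space A q then
     (let c = (SOME c. c \<in> A \<and> q \<in> fst c)
      in frechet_derivative (f \<circ> chart_inv c) (at (snd c q)) (v c)) else 0)"

definition riemannian_metric ::
  "('q, 'e::euclidean_space) chart set \<Rightarrow> ('q \<Rightarrow> ('q, 'e) tvec \<Rightarrow> ('q, 'e) tvec \<Rightarrow> real) \<Rightarrow> bool" where
  "riemannian_metric A g \<longleftrightarrow>
     (\<forall>q\<in>\<Union>(fst ` A). \<forall>v\<in>tangent_space A q.
        linear_form_on (tangent_space A q) (g q v) \<and>
        (\<forall>w\<in>tangent_space A q. g q v w = g q w v) \<and>
        (v \<noteq> 0 \<longrightarrow> g q v v > 0)) \<and>
     (\<forall>c\<in>A. \<forall>b\<in>Basis. \<forall>b'\<in>Basis. smooth_on (snd c ` fst c)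
        ((\<lambda>q. g q (coord_vector A c b q) (coord_vector A c b' q)) \<circ> chart_inv c))"


section \<open>Natural Lagrangians and nonholonomic constraints\<close>

definition natural_lagrangian ::
  "('q \<Rightarrow> ('q, 'e) tvec \<Rightarrow> ('q, 'e) tvec \<Rightarrow> real) \<Rightarrow> ('q \<Rightarrow> real) \<Rightarrow>
   'q \<times> ('q, 'e) tvec \<Rightarrow> real"
  where "natural_lagrangian g V = (\<lambda>(q, v). 1/2 * g q v v - V q)"

text \<open>The fiber derivative of \<open>natural_lagrangian g V\<close> (see \<open>FL_is_fiber_derivative\<close> below),
  as a map from the tangent space at \<open>q\<close> to the cotangent space at \<open>q\<close>.\<close>

definition FL ::
  "('q, 'e::euclidean_space) chart set \<Rightarrow> ('q \<Rightarrow> ('q, 'e) tvec \<Rightarrow> ('q, 'e) tvec \<Rightarrow> real) \<Rightarrow>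
   'q \<Rightarrow> ('q, 'e) tvec \<Rightarrow> ('q, 'e) covec"
  where "FL A g q v = (\<lambda>w. if w \<in> tangent_space A q then g q v w else 0)"

definition FL_inv ::
  "('q, 'e::euclidean_space) chart set \<Rightarrow> ('q \<Rightarrow> ('q, 'e) tvec \<Rightarrow> ('q, 'e) tvec \<Rightarrow> real) \<Rightarrow>
   'q \<Rightarrow> ('q, 'e) covec \<Rightarrow> ('q, 'e) tvec"
  where "FL_inv A g q = inv_into (tangent_space A q) (FL A g q)"

definition gradient ::
  "('q, 'e::euclidean_space) chart set \<Rightarrow> ('q \<Rightarrow> ('q, 'e) tvec \<Rightarrow> ('q, 'e) tvec \<Rightarrow> real) \<Rightarrow>
   ('q \<Rightarrow> real) \<Rightarrow> 'q \<Rightarrow> ('q, 'e) tvec"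
  where "gradient A g f q = FL_inv A g q (differential A f q)"

definition distribution ::
  "'q topology \<Rightarrow> ('q, 'e::euclidean_space) chart set \<Rightarrow> ('m \<Rightarrow> 'q \<Rightarrow> ('q, 'e) covec) \<Rightarrow>
   ('q \<times> ('q, 'e) tvec) set"
  where "distribution Q A \<eta> = {(q, v) \<in> tangent_bundle Q A. \<forall>k. \<eta> k q v = 0}"

definition annihilator ::
  "'q topology \<Rightarrow> ('q, 'e::euclidean_space) chart set \<Rightarrow> ('q \<times> ('q, 'e) tvec) set \<Rightarrow>
   ('q \<times> ('q, 'e) covec) set"
  where "annihilator Q A D = {(q, \<alpha>) \<in> cotangent_bundle Q A. \<forall>v. (q, v) \<in> D \<longrightarrow> \<alpha> v = 0}"

definition dual_field ::
  "('q, 'e::euclidean_space) chart set \<Rightarrow> ('q \<Rightarrow> ('q, 'e) tvec \<Rightarrow> ('q, 'e) tvec \<Rightarrow> real) \<Rightarrow>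
   ('m \<Rightarrow> 'q \<Rightarrow> ('q, 'e) covec) \<Rightarrow> 'm \<Rightarrow> 'q \<Rightarrow> ('q, 'e) tvec"
  where "dual_field A g \<eta> k q = FL_inv A g q (\<eta> k q)"

text \<open>The matrix \<open>m\<^sup>\<alpha>\<^sup>\<beta>\<close>; its inverse is \<open>m\<^sub>\<alpha>\<^sub>\<beta>\<close>.\<close>

definition constraint_mass ::
  "('q, 'e::euclidean_space) chart set \<Rightarrow> ('q \<Rightarrow> ('q, 'e) tvec \<Rightarrow> ('q, 'e) tvec \<Rightarrow> real) \<Rightarrow>
   ('m::finite \<Rightarrow> 'q \<Rightarrow> ('q, 'e) covec) \<Rightarrow> 'q \<Rightarrow> real^'m^'m"
  where "constraint_mass A g \<eta> q = (\<chi> \<alpha> \<beta>. \<eta> \<alpha> q (dual_field A g \<eta> \<beta> q))"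


section \<open>Nonholonomic impacts\<close>

definition impact_surface :: "'q topology \<Rightarrow> ('q \<Rightarrow> real) \<Rightarrow> 'q set"
  where "impact_surface Q h = {q \<in> topspace Q. h q = 0}"

definition impact_states ::
  "'q topology \<Rightarrow> ('q, 'e::euclidean_space) chart set \<Rightarrow> ('m \<Rightarrow> 'q \<Rightarrow> ('q, 'e) covec) \<Rightarrow>
   ('q \<Rightarrow> real) \<Rightarrow> ('q \<times> ('q, 'e) tvec) set"
  where "impact_states Q A \<eta> h =
    {(q, v) \<in> distribution Q A \<eta>. h q = 0 \<and> differential A h q v < 0}"

text \<open>Here \<open>v\<close> is the velocity before and \<open>v'\<close> the velocity after the impact at \<open>q\<close>, and
  \<open>l\<close>, \<open>e\<close> are the multipliers of the constraint forms and of the differential of \<open>h\<close>.\<close>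

definition corner_conditions ::
  "('q, 'e::euclidean_space) chart set \<Rightarrow> ('q \<Rightarrow> ('q, 'e) tvec \<Rightarrow> ('q, 'e) tvec \<Rightarrow> real) \<Rightarrow>
   ('q \<Rightarrow> real) \<Rightarrow> ('m::finite \<Rightarrow> 'q \<Rightarrow> ('q, 'e) covec) \<Rightarrow> ('q \<Rightarrow> real) \<Rightarrow>
   'q \<Rightarrow> ('q, 'e) tvec \<Rightarrow> ('q, 'e) tvec \<Rightarrow> ('m \<Rightarrow> real) \<Rightarrow> real \<Rightarrow> bool" where
  "corner_conditions A g V \<eta> h q v v' l e \<longleftrightarrow>
     v' \<in> tangent_space A q \<and>
     FL A g q v' - FL A g q v = (\<Sum>k\<in>UNIV. l k *\<^sub>R \<eta> k q) + e *\<^sub>R differential A h q \<and>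
     natural_lagrangian g V (q, v') - FL A g q v' v' = natural_lagrangian g V (q, v) - FL A g q v v \<and>
     (\<forall>k. \<eta> k q v' = 0)"

definition nonholonomic_impact_map ::
  "('q, 'e::euclidean_space) chart set \<Rightarrow> ('q \<Rightarrow> ('q, 'e) tvec \<Rightarrow> ('q, 'e) tvec \<Rightarrow> real) \<Rightarrow>
   ('q \<Rightarrow> real) \<Rightarrow> ('m::finite \<Rightarrow> 'q \<Rightarrow> ('q, 'e) covec) \<Rightarrow> ('q \<Rightarrow> real) \<Rightarrow>
   'q \<times> ('q, 'e) tvec \<Rightarrow> 'q \<times> ('q, 'e) tvec" where
  "nonholonomic_impact_map A g V \<eta> h =
     (\<lambda>(q, v). (q, THE v'. \<exists>l e. e \<noteq> 0 \<and> corner_conditions A g V \<eta> h q v v' l e))"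


section \<open>Consistency of the definitions\<close>

lemma smooth_on_differentiable: "smooth_on S f \<Longrightarrow> x \<in> S \<Longrightarrow> f differentiable (at x)"
  unfolding smooth_on_def by (metis Ck_on.simps(2))

lemma differential_eq:
  fixes A :: "('q, 'e::euclidean_space) chart set"
  assumes M: "smooth_manifold Q A" and f: "smooth_fun A f"
    and c: "c \<in> A" "q \<in> fst c" and v: "v \<in> tangent_space A q"
  shows "differential A f q v = frechet_derivative (f \<circ> chart_inv c) (at (snd c q)) (v c)"
proof -
  define d where "d = (SOME c. c \<in> A \<and> q \<in> fst c)"
  have d: "d \<in> A" "q \<in> fst d"
    using someI[of "\<lambda>c. c \<in> A \<and> q \<in> fst c" c] c unfolding d_def by auto
  have dp: "differential A f q v = frechet_derivative (f \<circ> chart_inv d) (at (snd d q)) (v d)"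
    using v by (simp add: differential_def d_def Let_def)
  have ch: "openin Q (fst x) \<and> open (snd x ` fst x) \<and>
      homeomorphic_map (subtopology Q (fst x)) (top_of_set (snd x ` fst x)) (snd x)"
    if "x \<in> A" for x
    using M that unfolding smooth_manifold_def by (cases x) auto
  have inj: "inj_on (snd x) (fst x)" if "x \<in> A" for x
    using ch[OF that] openin_subset[of Q "fst x"]
    by (auto simp: homeomorphic_map_def quotient_map_def topspace_subtopology Int_absorb1)
  let ?N = "snd c ` (fst c \<inter> fst d)"
  have "openin (subtopology Q (fst c)) (fst c \<inter> fst d)"
    using ch[OF d(1)] by (simp add: openin_subtopology_Int2)
  then have "openin (top_of_set (snd c ` fst c)) ?N"
    using ch[OF c(1)] homeomorphic_imp_open_map open_map_def by metis
  then have N: "open ?N" using ch[OF c(1)] openin_open_trans by blast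
  have qN: "snd c q \<in> ?N" using c d by auto
  have ci: "chart_inv x (snd x p) = p" if "x \<in> A" "p \<in> fst x" for x p
    using inj that by (simp add: chart_inv_def)
  have t: "transition c d differentiable at (snd c q)"
    using M c d qN unfolding smooth_manifold_def by (meson smooth_on_differentiable)
  have tq: "transition c d (snd c q) = snd d q" using c by (simp add: transition_def ci)
  have fd: "(f \<circ> chart_inv d) differentiable at (snd d q)"
    using f d unfolding smooth_fun_def by (meson smooth_on_differentiable imageI)
  have "((f \<circ> chart_inv d) \<circ> transition c d has_derivative
      frechet_derivative (f \<circ> chart_inv d) (at (snd d q)) \<circ>
      frechet_derivative (transition c d) (at (snd c q))) (at (snd c q))"
    using t fd tq by (intro diff_chain_at) (simp_all add: frechet_derivative_works[symmetric])
  then have "(f \<circ> chart_inv c has_derivative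
      frechet_derivative (f \<circ> chart_inv d) (at (snd d q)) \<circ>
      frechet_derivative (transition c d) (at (snd c q))) (at (snd c q))"
  proof (rule has_derivative_transform_within_open[OF _ N qN])
    show "((f \<circ> chart_inv d) \<circ> transition c d) x = (f \<circ> chart_inv c) x" if "x \<in> ?N" for x
      using that c d by (auto simp: transition_def ci)
  qed
  then have "frechet_derivative (f \<circ> chart_inv c) (at (snd c q)) (v c) =
      frechet_derivative (f \<circ> chart_inv d) (at (snd d q))
        (frechet_derivative (transition c d) (at (snd c q)) (v c))"
    by (simp add: frechet_derivative_at[symmetric])
  also have "frechet_derivative (transition c d) (at (snd c q)) (v c) = v d"
    using v c d unfolding tangent_space_def mem_Collect_eq by (metis IntI)
  finally show ?thesis using dp by (rule trans[OF _ sym, rotated])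
qed

lemma tangent_space_subspace:
  fixes A :: "('q, 'e::euclidean_space) chart set"
  assumes M: "smooth_manifold Q A"
  shows "subspace (tangent_space A q)"
proof -
  have l: "linear (frechet_derivative (transition c c') (at (snd c q)))"
    if "c \<in> A" "c' \<in> A" "q \<in> fst c \<inter> fst c'" for c c'
  proof -
    have "transition c c' differentiable at (snd c q)"
      using M that unfolding smooth_manifold_def by (meson smooth_on_differentiable imageI)
    then show ?thesis by (rule linear_frechet_derivative)
  qed
  have t: "v c' = frechet_derivative (transition c c') (at (snd c q)) (v c)"
    if "v \<in> tangent_space A q" "c \<in> A" "c' \<in> A" "q \<in> fst c \<inter> fst c'" for v c c'
    using that unfolding tangent_space_def mem_Collect_eq by blast
  have z: "v c = 0" if "v \<in> tangent_space A q" "\<not> (c \<in> A \<and> q \<in> fst c)" for v c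
    using that unfolding tangent_space_def mem_Collect_eq by blast
  show ?thesis
  proof (rule subspaceI)
    show "0 \<in> tangent_space A q"
      using linear_0[OF l] unfolding tangent_space_def mem_Collect_eq zero_fun_def by auto
  next
    fix x y
    assume x: "x \<in> tangent_space A q" and y: "y \<in> tangent_space A q"
    show "x + y \<in> tangent_space A q"
      unfolding tangent_space_def mem_Collect_eq plus_fun_def
    proof (intro conjI ballI allI impI)
      fix c c' assume c: "c \<in> A" "c' \<in> A" "q \<in> fst c \<inter> fst c'"
      show "x c' + y c' = frechet_derivative (transition c c') (at (snd c q)) (x c + y c)"
        using linear_add[OF l[OF c], of "x c" "y c"] t[OF x c] t[OF y c] by metis
    next
      fix c assume c: "\<not> (c \<in> A \<and> q \<in> fst c)"
      show "x c + y c = 0" using z[OF x c] z[OF y c] by simp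
    qed
  next
    fix r x
    assume x: "x \<in> tangent_space A q"
    show "r *\<^sub>R x \<in> tangent_space A q"
      unfolding tangent_space_def mem_Collect_eq scaleR_fun_def
    proof (intro conjI ballI allI impI)
      fix c c' assume c: "c \<in> A" "c' \<in> A" "q \<in> fst c \<inter> fst c'"
      show "r *\<^sub>R x c' = frechet_derivative (transition c c') (at (snd c q)) (r *\<^sub>R x c)"
        using linear_scale[OF l[OF c], of r "x c"] t[OF x c] by metis
    next
      fix c assume c: "\<not> (c \<in> A \<and> q \<in> fst c)"
      show "r *\<^sub>R x c = 0" using z[OF x c] by simp
    qed
  qed
qed

lemma FL_is_fiber_derivative:
  fixes A :: "('q, 'e::euclidean_space) chart set"
  assumes M: "smooth_manifold Q A" and g: "riemannian_metric A g" and q: "q \<in> topspace Q"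
    and v: "v \<in> tangent_space A q" and w: "w \<in> tangent_space A q"
  shows "((\<lambda>t. natural_lagrangian g V (q, v + t *\<^sub>R w)) has_real_derivative FL A g q v w) (at 0)"
proof -
  let ?T = "tangent_space A q"
  have q': "q \<in> \<Union>(fst ` A)" using M q by (simp add: smooth_manifold_def)
  have S: "subspace ?T" by (rule tangent_space_subspace[OF M])
  have add: "g q x (y + z) = g q x y + g q x z" and scale: "g q x (r *\<^sub>R y) = r * g q x y"
    and sym: "g q x y = g q y x" if "x \<in> ?T" "y \<in> ?T" "z \<in> ?T" for x y z r
    using g q' that unfolding riemannian_metric_def linear_form_on_def by blast+
  have "natural_lagrangian g V (q, v + t *\<^sub>R w) =
      1/2 * (g q v v + 2 * t * g q v w + t^2 * g q w w) - V q" for t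
  proof -
    have tw: "t *\<^sub>R w \<in> ?T" using S w by (rule subspace_scale)
    then have s: "v + t *\<^sub>R w \<in> ?T" using S v by (simp add: subspace_add)
    have "g q (v + t *\<^sub>R w) (v + t *\<^sub>R w) = g q v (v + t *\<^sub>R w) + t * g q w (v + t *\<^sub>R w)"
      using add[OF s v tw] scale[OF s w w, of t] sym[OF s v v] sym[OF s w w] by simp
    also have "\<dots> = g q v v + t * g q v w + t * (g q w v + t * g q w w)"
      using add[OF v v tw] scale[OF v w w, of t] add[OF w v tw] scale[OF w w w, of t] by simp
    finally show ?thesis
      using sym[OF v w w] by (simp add: natural_lagrangian_def algebra_simps power2_eq_square)
  qed
  then show ?thesis
    using w by (auto simp: FL_def intro!: derivative_eq_intros)
qed

end

theory Submission
  imports Defs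
begin

text \<open>The momentum condition says that the velocity jumps by a combination of the \<open>W\<^sup>k\<close> and of
  the gradient. The constraints after the impact force this jump to be a multiple \<open>\<epsilon> n\<close>, where \<open>n\<close>
  is the component of the gradient that is orthogonal to all \<open>W\<^sup>k\<close>; it is nonzero because \<open>dh\<close> does
  not annihilate the distribution, and the denominator in the formulas is \<open>g(n, n)\<close>. Conservation
  of energy then reads \<open>2 \<epsilon> g(v, n) + \<epsilon>\<^sup>2 g(n, n) = 0\<close> with \<open>g(v, n) = dh(v)\<close>, a quadratic equation
  with exactly one nonzero root. Since \<open>\<epsilon> = -2 dh(v) / g(n, n)\<close>, the impact reflects \<open>v\<close> along
  \<open>n\<close>.\<close>

section \<open>Inner products on subspaces\<close>

text \<open>Tangent spaces are subsets of the type of all chart-indexed families, so the inner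
  product lives on a subspace \<open>T\<close> and nothing is assumed about \<open>g\<close> outside
  it. Linearity in the left argument comes from symmetry.\<close>

locale inner_on =
  fixes T :: "'v::real_vector set" and g :: "'v \<Rightarrow> 'v \<Rightarrow> real"
  assumes subspace: "subspace T"
    and add_right: "\<lbrakk>x \<in> T; y \<in> T; z \<in> T\<rbrakk> \<Longrightarrow> g x (y + z) = g x y + g x z"
    and scale_right: "\<lbrakk>x \<in> T; y \<in> T\<rbrakk> \<Longrightarrow> g x (r *\<^sub>R y) = r * g x y"
    and sym: "\<lbrakk>x \<in> T; y \<in> T\<rbrakk> \<Longrightarrow> g x y = g y x"
    and pos: "\<lbrakk>x \<in> T; x \<noteq> 0\<rbrakk> \<Longrightarrow> g x x > 0"
begin

lemmas closed = subspace_0[OF subspace] subspace_add[OF subspace] subspace_diff[OF subspace]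
  subspace_scale[OF subspace] subspace_sum[OF subspace]

lemma add_left: "\<lbrakk>x \<in> T; y \<in> T; z \<in> T\<rbrakk> \<Longrightarrow> g (x + y) z = g x z + g y z"
  by (metis add_right sym closed(2))

lemma scale_left: "\<lbrakk>x \<in> T; y \<in> T\<rbrakk> \<Longrightarrow> g (r *\<^sub>R x) y = r * g x y"
  by (metis scale_right sym closed(4))

lemma zero_right [simp]: "x \<in> T \<Longrightarrow> g x 0 = 0"
  using scale_right[of x x 0] by simp

lemma zero_left [simp]: "x \<in> T \<Longrightarrow> g 0 x = 0"
  using scale_left[of x x 0] by simp

lemma diff_right: "\<lbrakk>x \<in> T; y \<in> T; z \<in> T\<rbrakk> \<Longrightarrow> g x (y - z) = g x y - g x z"
  using add_right[of x "y - z" z] closed(3)[of y z] by simp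

lemma diff_left: "\<lbrakk>x \<in> T; y \<in> T; z \<in> T\<rbrakk> \<Longrightarrow> g (x - y) z = g x z - g y z"
  by (metis diff_right sym closed(3))

lemma sum_right:
  assumes "x \<in> T" "\<And>i. i \<in> I \<Longrightarrow> f i \<in> T"
  shows "g x (\<Sum>i\<in>I. r i *\<^sub>R f i) = (\<Sum>i\<in>I. r i * g x (f i))"
  using assms
  by (induction I rule: infinite_finite_induct)
    (simp_all add: add_right scale_right closed)

lemma eqI:
  assumes "x \<in> T" "y \<in> T" "\<And>z. z \<in> T \<Longrightarrow> g x z = g y z"
  shows "x = y"
proof (rule ccontr)
  assume "x \<noteq> y"
  then have "g (x - y) (x - y) > 0" using assms by (intro pos closed) auto
  moreover have "g (x - y) (x - y) = 0" using assms closed(3) by (simp add: diff_left)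
  ultimately show False by simp
qed

text \<open>A Gram-Schmidt argument: on adding \<open>b\<close>, the part \<open>n\<close> of
  \<open>b\<close> orthogonal to \<open>span B\<close> is split off, and the representative
  \<open>u\<close> found on \<open>span B\<close> is corrected by a multiple of \<open>n\<close>.
  The correction leaves the values on \<open>span B\<close> unchanged. The vectors in
  \<open>B\<close> may be dependent.\<close>

lemma riesz_span:
  assumes "finite B" "B \<subseteq> T" "linear_form_on T \<alpha>"
  shows "\<exists>u\<in>span B. \<forall>x\<in>span B. g u x = \<alpha> x"
  using assms
proof (induction B arbitrary: \<alpha> rule: finite_induct)
  case empty
  then have "\<alpha> (0 *\<^sub>R 0) = 0 * \<alpha> 0" using closed(1) unfolding linear_form_on_def by blast
  then show ?case using closed(1) by simp
next
  case (insert b B)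
  have b: "b \<in> T" and B: "B \<subseteq> T" using insert.prems by auto
  have sT: "x \<in> T" if "x \<in> span B" for x using that B span_minimal subspace by blast
  have \<alpha>: "\<alpha> (x + y) = \<alpha> x + \<alpha> y" "\<alpha> (r *\<^sub>R x) = r * \<alpha> x" if "x \<in> T" "y \<in> T" for x y r
    using insert.prems that unfolding linear_form_on_def by blast+
  obtain u where u: "u \<in> span B" "\<And>x. x \<in> span B \<Longrightarrow> g u x = \<alpha> x"
    using insert.IH[OF B insert.prems(2)] by blast
  \<comment> \<open>The induction hypothesis is used a second time, for the functional
    \<open>g b\<close>: its representative \<open>p\<close> is the orthogonal projection of
    \<open>b\<close> onto \<open>span B\<close>.\<close>
  have "linear_form_on T (g b)" using b by (simp add: linear_form_on_def add_right scale_right)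
  then obtain p where p: "p \<in> span B" "\<And>x. x \<in> span B \<Longrightarrow> g p x = g b x"
    using insert.IH[OF B] by blast
  define n where "n = b - p"
  have n: "n \<in> T" and pT: "p \<in> T" and uT: "u \<in> T" unfolding n_def using b p u sT closed(3) by auto
  have no: "g n x = 0" if "x \<in> span B" for x
    unfolding n_def using that p b sT by (simp add: diff_left)
  have dec: "\<exists>y\<in>span B. \<exists>k. x = y + k *\<^sub>R n" if "x \<in> span (insert b B)" for x
  proof -
    obtain k where k: "x - k *\<^sub>R b \<in> span B" using \<open>x \<in> span (insert b B)\<close> by (auto simp: span_insert)
    have "x = ((x - k *\<^sub>R b) + k *\<^sub>R p) + k *\<^sub>R n" by (simp add: n_def algebra_simps)
    then show ?thesis using k p(1) span_add span_scale by blast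
  qed
  have mono: "span B \<subseteq> span (insert b B)" by (intro span_mono) auto
  have ns: "n \<in> span (insert b B)"
    unfolding n_def using p(1) mono by (auto intro: span_diff span_base)
  define t where "t = (\<alpha> n - g u n) / g n n"
  define w where "w = u + t *\<^sub>R n"
  have wT: "w \<in> T" and ws: "w \<in> span (insert b B)"
    unfolding w_def using u(1) uT n ns mono by (auto intro: closed span_add span_scale)
  \<comment> \<open>If \<open>b\<close> already lies in \<open>span B\<close>, then
    \<open>n = 0\<close>; both sides vanish and the division by zero in \<open>t\<close> is
    harmless.\<close>
  have t: "t * g n n = \<alpha> n - g u n"
  proof (cases "n = 0")
    case True
    have "\<alpha> (0 *\<^sub>R n) = 0" using \<alpha>(2)[OF n n, of 0] by simp
    then show ?thesis using True uT n by simp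
  qed (use pos[OF n] in \<open>simp add: t_def\<close>)
  have "g w x = \<alpha> x" if x: "x \<in> span (insert b B)" for x
  proof -
    obtain y k where y: "y \<in> span B" and x: "x = y + k *\<^sub>R n" using dec[OF x] by blast
    have yT: "y \<in> T" using y sT by blast
    have "g w x = g w y + k * g w n"
      unfolding x using wT yT n by (simp add: add_right scale_right closed)
    also have "\<dots> = \<alpha> y + k * \<alpha> n"
      using yT n uT u(2)[OF y] no[OF y] t by (simp add: w_def add_left scale_left closed)
    also have "\<dots> = \<alpha> x"
      unfolding x using \<alpha> yT n by (simp add: closed)
    finally show ?thesis .
  qed
  then show ?case using ws by blast
qed

lemma riesz:
  assumes "finite B" "B \<subseteq> T" "T \<subseteq> span B" "linear_form_on T \<alpha>"
  obtains u where "u \<in> T" "\<And>x. x \<in> T \<Longrightarrow> g u x = \<alpha> x"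
proof -
  have "span B = T" using assms span_minimal subspace by blast
  then show thesis using riesz_span[OF assms(1,2,4)] that by auto
qed

text \<open>A vector \<open>x\<close> in the kernel of the Gram matrix yields a combination
  \<open>w\<close> of the \<open>W k\<close> that is orthogonal to every \<open>W k\<close>, hence
  to itself. So \<open>w = 0\<close>, and independence gives \<open>x = 0\<close>.\<close>

lemma gram_invertible:
  fixes W :: "'m::finite \<Rightarrow> 'v" and M :: "real^'m^'m"
  assumes W: "\<And>k. W k \<in> T"
    and M: "\<And>a b. M $ a $ b = g (W a) (W b)"
    and ind: "\<And>x::'m \<Rightarrow> real. (\<Sum>k\<in>UNIV. x k *\<^sub>R W k) = 0 \<Longrightarrow> x = (\<lambda>_. 0)"
  shows "invertible M"
proof -
  have "x = 0" if "M *v x = 0" for x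
  proof -
    define w where "w = (\<Sum>k\<in>UNIV. x $ k *\<^sub>R W k)"
    have wT: "w \<in> T" unfolding w_def using W by (auto intro!: closed)
    have o: "g (W a) w = 0" for a
    proof -
      have "g (W a) w = (M *v x) $ a"
        unfolding w_def using W by (simp add: sum_right M matrix_vector_mult_def mult.commute)
      then show ?thesis using that by simp
    qed
    have "g w w = (\<Sum>k\<in>UNIV. x $ k * g w (W k))"
      using sum_right[of w UNIV W "\<lambda>k. x $ k"] wT W by (simp add: w_def)
    also have "\<dots> = 0" using o sym[OF wT W] by simp
    finally have "w = 0" using pos[OF wT] by fastforce
    then have "(\<lambda>k. x $ k) = (\<lambda>_. 0)" using ind[of "\<lambda>k. x $ k"] by (simp add: w_def)
    then show ?thesis by (simp add: vec_eq_iff fun_eq_iff)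
  qed
  then show ?thesis
    by (meson invertible_left_inverse matrix_left_invertible_ker)
qed

text \<open>The linear algebra of the impact, with \<open>N\<close> in the role of the gradient. The
  vector \<open>u\<close> witnesses that \<open>N\<close> is not a combination of the
  \<open>W k\<close>. The equivalence covers existence and uniqueness of the velocity and of both
  multipliers at once.\<close>

lemma constrained_reflection:
  fixes W :: "'m::finite \<Rightarrow> 'v" and M :: "real^'m^'m"
  assumes W: "\<And>k. W k \<in> T" and N: "N \<in> T" and v: "v \<in> T"
    and M: "\<And>a b. M $ a $ b = g (W a) (W b)" and inv: "invertible M"
    and u: "u \<in> T" "\<And>k. g (W k) u = 0" "g N u \<noteq> 0"
    and vo: "\<And>k. g (W k) v = 0" and Nv: "g N v \<noteq> 0"
    and den: "den = g N N -
      (\<Sum>\<alpha>\<in>UNIV. \<Sum>\<beta>\<in>UNIV. matrix_inv M $ \<alpha> $ \<beta> * g N (W \<alpha>) * g N (W \<beta>))"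
    and \<epsilon>: "\<epsilon> = - 2 * g N v / den"
    and \<Lambda>: "\<Lambda> = (\<lambda>k. (\<Sum>l\<in>UNIV. 2 * matrix_inv M $ k $ l * g N (W l) * g N v) / den)"
    and \<delta>: "\<delta> = v + (\<Sum>k\<in>UNIV. \<Lambda> k *\<^sub>R W k) + \<epsilon> *\<^sub>R N"
  shows "den \<noteq> 0"
    and "v' = v + (\<Sum>k\<in>UNIV. l k *\<^sub>R W k) + e *\<^sub>R N \<and> g v' v' = g v v \<and>
        (\<forall>k. g (W k) v' = 0) \<and> e \<noteq> 0 \<longleftrightarrow> v' = \<delta> \<and> l = \<Lambda> \<and> e = \<epsilon>"
proof -
  define a :: "real^'m" where "a = (\<chi> k. g N (W k))"
  \<comment> \<open>These are the coefficients of the orthogonal projection of \<open>N\<close> onto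
    the span of the \<open>W k\<close>: they solve the normal equations
    \<open>M *v c = a\<close>.\<close>
  define c where "c = matrix_inv M *v a"
  have ck: "c $ k = (\<Sum>l\<in>UNIV. matrix_inv M $ k $ l * g N (W l))" for k
    by (simp add: c_def a_def matrix_vector_mult_def)
  have inv': "M ** matrix_inv M = mat 1" "matrix_inv M ** M = mat 1"
    using someI_ex[OF inv[unfolded invertible_def]] by (simp_all add: matrix_inv_def)
  have Mc: "M *v c = a" by (simp add: c_def matrix_vector_mul_assoc inv')
  have Minj: "y = z" if "M *v y = M *v z" for y z
    using that inv'(2) by (metis matrix_vector_mul_assoc matrix_vector_mul_lid)
  have Wsum: "g (W k) (\<Sum>j\<in>UNIV. x j *\<^sub>R W j) = (M *v (\<chi> j. x j)) $ k" for k x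
    using W by (simp add: sum_right M matrix_vector_mult_def mult.commute)
  have sumT: "(\<Sum>j\<in>UNIV. x j *\<^sub>R W j) \<in> T" for x using W by (auto intro!: closed)
  define n where "n = N - (\<Sum>k\<in>UNIV. c $ k *\<^sub>R W k)"
  have nT: "n \<in> T" unfolding n_def by (intro closed N W)
  have ak: "a $ k = g (W k) N" for k using sym[OF N W] by (simp add: a_def)
  have Wn: "g (W k) n = 0" for k
    unfolding n_def using W N sumT
    by (simp add: diff_right Wsum ak[symmetric] Mc)
  \<comment> \<open>Removing a combination of the \<open>W k\<close> from \<open>N\<close> does not
    change its pairing with vectors orthogonal to all of them. With \<open>x\<close> equal to
    \<open>n\<close>, \<open>u\<close> and \<open>v\<close> this gives \<open>den = g n n\<close>,
    \<open>n \<noteq> 0\<close> and \<open>g v n = g N v\<close>.\<close>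
  have gn: "g x n = g x N" if "x \<in> T" "\<And>k. g (W k) x = 0" for x
  proof -
    have "g x (W k) = 0" for k using that sym[OF _ W] by simp
    then show ?thesis unfolding n_def using that W N sumT by (simp add: diff_right sum_right)
  qed
  have den': "den = g N n"
    unfolding n_def den using N W sumT
    by (simp add: diff_right sum_right ck sum_distrib_right sum_distrib_left ac_simps)
  have denn: "den = g n n" using gn[OF nT Wn] den' sym[OF N nT] by simp
  have "n \<noteq> 0" using gn[OF u(1,2)] u sym[OF N u(1)] by auto
  then show den0: "den \<noteq> 0" using pos[OF nT] denn by simp
  \<comment> \<open>The claimed multipliers are the projection coefficients scaled by
    \<open>- \<epsilon>\<close>, so by \<open>jump\<close> the total velocity change is
    \<open>\<epsilon> *\<^sub>R n\<close>.\<close>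
  have \<Lambda>': "\<Lambda> k = - \<epsilon> * c $ k" for k
    unfolding \<Lambda> \<epsilon> ck by (simp add: sum_distrib_left sum_divide_distrib ac_simps)
  have jump: "(\<Sum>k\<in>UNIV. (- e * c $ k) *\<^sub>R W k) + e *\<^sub>R N = e *\<^sub>R n" for e
    by (simp add: n_def scaleR_diff_right scaleR_sum_right sum_negf)
  have \<delta>': "\<delta> = v + \<epsilon> *\<^sub>R n" using jump[of \<epsilon>] by (simp add: \<delta> \<Lambda>' add.assoc)
  have \<epsilon>0: "\<epsilon> \<noteq> 0" using Nv den0 by (simp add: \<epsilon>)
  have gvn: "g v n = g N v" using gn[OF v vo] sym[OF N v] by simp
  \<comment> \<open>The energy change has the factor \<open>e\<close>; cancelling it for
    \<open>e \<noteq> 0\<close> leaves a linear equation whose root is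
    \<open>\<epsilon>\<close>.\<close>
  have energy: "g (v + e *\<^sub>R n) (v + e *\<^sub>R n) = g v v + e * (2 * g N v + e * den)" for e
    using v nT gvn sym[OF v nT]
    by (simp add: add_left add_right scale_left scale_right closed denn algebra_simps)
  show "v' = v + (\<Sum>k\<in>UNIV. l k *\<^sub>R W k) + e *\<^sub>R N \<and> g v' v' = g v v \<and>
      (\<forall>k. g (W k) v' = 0) \<and> e \<noteq> 0 \<longleftrightarrow> v' = \<delta> \<and> l = \<Lambda> \<and> e = \<epsilon>" (is "?L \<longleftrightarrow> ?R")
  proof
    assume L: ?L
    \<comment> \<open>Pairing the velocity after the impact with \<open>W k\<close> turns the
      constraints into a linear system for the multipliers, which determines \<open>l\<close> once
      \<open>e\<close> is given.\<close>
    have "(M *v (\<chi> j. l j)) $ k = (M *v (- e *\<^sub>R c)) $ k" for k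
    proof -
      have "0 = g (W k) (v + (\<Sum>k\<in>UNIV. l k *\<^sub>R W k) + e *\<^sub>R N)" using L by metis
      also have "\<dots> = (M *v (\<chi> j. l j)) $ k + e * a $ k"
        using W v N sumT by (simp add: add_right scale_right closed vo Wsum ak)
      finally show ?thesis by (simp only: matrix_vector_mult_scaleR Mc) simp
    qed
    then have "M *v (\<chi> j. l j) = M *v (- e *\<^sub>R c)" by (simp only: vec_eq_iff) simp
    then have "(\<chi> j. l j) = - e *\<^sub>R c" by (rule Minj)
    then have l: "l k = - e * c $ k" for k by (simp add: vec_eq_iff)
    then have v': "v' = v + e *\<^sub>R n" using L jump[of e] by (simp add: add.assoc)
    have "g v' v' = g v v" "e \<noteq> 0" using L by auto
    then have "2 * g N v + e * den = 0" using energy[of e, folded v'] by simp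
    then have e: "e = \<epsilon>" using den0 by (simp add: \<epsilon> field_simps)
    then show ?R using v' \<delta>' l \<Lambda>' by (auto simp: fun_eq_iff)
  next
    assume R: ?R
    have "\<epsilon> * den = - 2 * g N v" using den0 by (simp add: \<epsilon>)
    then have "g \<delta> \<delta> = g v v" using energy[of \<epsilon>] by (simp add: \<delta>')
    moreover have "g (W k) \<delta> = 0" for k
      using W v nT by (simp add: \<delta>' add_right scale_right closed vo Wn)
    ultimately show ?L using R \<epsilon>0 \<delta> by simp
  qed
qed

end

section \<open>Tangent spaces\<close>

lemma sum_fun_apply: "(\<Sum>i\<in>I. f i) x = (\<Sum>i\<in>I. f i x)"
  for f :: "'i \<Rightarrow> 'a \<Rightarrow> 'b::comm_monoid_add"
  by (induction I rule: infinite_finite_induct) (simp_all add: zero_fun_def plus_fun_def)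

text \<open>A tangent vector is determined by its representative in a single chart.\<close>

lemma tangent_space_finite_span:
  fixes A :: "('q, 'e::euclidean_space) chart set"
  assumes M: "smooth_manifold Q A" and q: "q \<in> topspace Q"
  obtains B where "finite B" "B \<subseteq> tangent_space A q" "tangent_space A q \<subseteq> span B"
proof -
  let ?T = "tangent_space A q"
  have "q \<in> \<Union>(fst ` A)" using M q by (simp add: smooth_manifold_def)
  then obtain c where c: "c \<in> A" "q \<in> fst c" by blast
  let ?r = "\<lambda>v. v c"
  have lin: "linear ?r" by (rule linearI) (simp_all add: plus_fun_def scaleR_fun_def)
  have inj: "inj_on ?r ?T"
  proof (rule inj_onI, rule ext)
    fix v w d assume v: "v \<in> ?T" and w: "w \<in> ?T" and e: "v c = w c"
    show "v d = w d"
    proof (cases "d \<in> A \<and> q \<in> fst d")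
      case True
      then show ?thesis using v w e c unfolding tangent_space_def mem_Collect_eq by (metis IntI)
    next
      case False
      then show ?thesis using v w unfolding tangent_space_def mem_Collect_eq by metis
    qed
  qed
  \<comment> \<open>\<open>C\<close> is independent in a Euclidean space, hence finite, and so it is
    the image of a finite set \<open>B\<close> of tangent vectors.\<close>
  obtain C where C: "C \<subseteq> ?r ` ?T" "independent C" "?r ` ?T \<subseteq> span C"
    by (metis maximal_independent_subset)
  obtain B where B: "B \<subseteq> ?T" "finite B" "C = ?r ` B"
    using C(1) finite_subset_image[OF independent_imp_finite[OF C(2)]] by blast
  \<comment> \<open>As \<open>span B\<close> stays inside the tangent space, where taking the
    representative is injective, the inclusion of images lifts to the vectors themselves.\<close>
  have "span B \<subseteq> ?T" using span_minimal[OF B(1) tangent_space_subspace[OF M]] .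
  moreover have "?r ` ?T \<subseteq> ?r ` span B"
    using C(3) B(3) linear_span_image[OF lin] by metis
  ultimately have "?T \<subseteq> span B" using inj by (simp add: inj_on_image_subset_iff)
  then show thesis using B that by blast
qed

lemma differential_in_cotangent_space:
  fixes A :: "('q, 'e::euclidean_space) chart set"
  assumes M: "smooth_manifold Q A" and f: "smooth_fun A f" and q: "q \<in> topspace Q"
  shows "differential A f q \<in> cotangent_space A q"
proof -
  let ?T = "tangent_space A q"
  note S = tangent_space_subspace[OF M, of q]
  have "q \<in> \<Union>(fst ` A)" using M q by (simp add: smooth_manifold_def)
  then obtain c where c: "c \<in> A" "q \<in> fst c" by blast
  let ?D = "frechet_derivative (f \<circ> chart_inv c) (at (snd c q))"
  note eq = differential_eq[OF M f c]
  have "(f \<circ> chart_inv c) differentiable (at (snd c q))"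
    using f c unfolding smooth_fun_def by (meson smooth_on_differentiable imageI)
  then have l: "linear ?D" by (rule linear_frechet_derivative)
  have "differential A f q (v + w) = differential A f q v + differential A f q w"
    if "v \<in> ?T" "w \<in> ?T" for v w
    using that eq subspace_add[OF S that] linear_add[OF l] by (simp add: plus_fun_def)
  moreover have "differential A f q (r *\<^sub>R v) = r * differential A f q v" if "v \<in> ?T" for v r
    using that eq subspace_scale[OF S that] linear_scale[OF l] by (simp add: scaleR_fun_def)
  ultimately show ?thesis
    by (simp add: cotangent_space_def linear_form_on_def) (simp add: differential_def)
qed

lemma inner_on_tangent_space:
  fixes A :: "('q, 'e::euclidean_space) chart set"
  assumes M: "smooth_manifold Q A" and g: "riemannian_metric A g" and q: "q \<in> topspace Q"
  shows "inner_on (tangent_space A q) (g q)"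
proof -
  have q': "q \<in> \<Union>(fst ` A)" using M q by (simp add: smooth_manifold_def)
  note G = g[unfolded riemannian_metric_def linear_form_on_def, THEN conjunct1, rule_format, OF q']
  show ?thesis
    by (rule inner_on.intro) (use G tangent_space_subspace[OF M] in blast)+
qed

text \<open>\<open>inv_into\<close> inverts \<open>FL\<close> only on its image, so the point is
  surjectivity onto the cotangent space. The Riesz representation on the finite-dimensional tangent
  space provides it; off that space both functions are \<open>0\<close>.\<close>

lemma FL_inv:
  fixes A :: "('q, 'e::euclidean_space) chart set"
  assumes M: "smooth_manifold Q A" and g: "riemannian_metric A g" and q: "q \<in> topspace Q"
    and \<alpha>: "\<alpha> \<in> cotangent_space A q"
  shows "FL_inv A g q \<alpha> \<in> tangent_space A q"
    and "FL A g q (FL_inv A g q \<alpha>) = \<alpha>"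
proof -
  interpret inner_on "tangent_space A q" "g q" by (rule inner_on_tangent_space[OF M g q])
  obtain B where B: "finite B" "B \<subseteq> tangent_space A q" "tangent_space A q \<subseteq> span B"
    using tangent_space_finite_span[OF M q] .
  have "linear_form_on (tangent_space A q) \<alpha>" using \<alpha> by (simp add: cotangent_space_def)
  then obtain u where u: "u \<in> tangent_space A q" "\<And>x. x \<in> tangent_space A q \<Longrightarrow> g q u x = \<alpha> x"
    using riesz[OF B] by blast
  have "FL A g q u = \<alpha>" using u(2) \<alpha> by (auto simp: FL_def cotangent_space_def fun_eq_iff)
  then have "\<alpha> \<in> FL A g q ` tangent_space A q" using u(1) by blast
  then show "FL_inv A g q \<alpha> \<in> tangent_space A q" "FL A g q (FL_inv A g q \<alpha>) = \<alpha>"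
    unfolding FL_inv_def by (rule inv_into_into, rule f_inv_into_f)
qed

text \<open>Independence of a range ignores repetitions; injectivity excludes them, so a relation
  between indexed forms becomes one between distinct elements.\<close>

lemma independent_family_zero:
  fixes f :: "'m::finite \<Rightarrow> 'v::real_vector"
  assumes "inj f" "independent (range f)" "(\<Sum>k\<in>UNIV. x k *\<^sub>R f k) = 0"
  shows "x = (\<lambda>_. 0)"
proof
  fix k
  have "(\<Sum>y\<in>range f. x (inv f y) *\<^sub>R y) = 0"
    using assms(1,3) by (simp add: sum.reindex)
  then have "x (inv f (f k)) = 0"
    using independentD[OF assms(2), of "range f" "\<lambda>y. x (inv f y)" "f k"] by simp
  then show "x k = 0" using assms(1) by simp
qed

section \<open>The impact map\<close>

text \<open>The theorem at a single impact state. \<open>FL\<close> carries the corner conditions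
  from covectors to tangent vectors, where \<open>constrained_reflection\<close> solves
  them.\<close>

lemma impact_at_point:
  fixes A :: "('q, 'e::euclidean_space) chart set" and \<eta> :: "'m::finite \<Rightarrow> 'q \<Rightarrow> ('q, 'e) covec"
  assumes M: "smooth_manifold Q A" and g: "riemannian_metric A g"
    and \<eta>: "\<And>k. smooth_one_form A (\<eta> k)"
    and ind: "inj (\<lambda>k. \<eta> k q)" "independent (range (\<lambda>k. \<eta> k q))"
    and h: "smooth_fun A h"
    and ann: "(q, differential A h q) \<notin> annihilator Q A (distribution Q A \<eta>)"
    and st: "(q, v) \<in> impact_states Q A \<eta> h"
    and m: "m = constraint_mass A g \<eta> q"
    and dh: "dh = differential A h q"
    and grad: "grad = gradient A g h q"
    and W: "W = (\<lambda>k. dual_field A g \<eta> k q)"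
    and den: "den = dh grad -
      (\<Sum>\<alpha>\<in>UNIV. \<Sum>\<beta>\<in>UNIV. matrix_inv m $ \<alpha> $ \<beta> * dh (W \<alpha>) * dh (W \<beta>))"
    and \<epsilon>: "\<epsilon> = - 2 * dh v / den"
    and \<Lambda>: "\<Lambda> = (\<lambda>k. (\<Sum>l\<in>UNIV. 2 * matrix_inv m $ k $ l * dh (W l) * dh v) / den)"
    and \<delta>: "\<delta> = v + (\<Sum>k\<in>UNIV. \<Lambda> k *\<^sub>R W k) + \<epsilon> *\<^sub>R grad"
  shows "invertible m" and "den \<noteq> 0"
    and "corner_conditions A g V \<eta> h q v v' l e \<and> e \<noteq> 0 \<longleftrightarrow> v' = \<delta> \<and> l = \<Lambda> \<and> e = \<epsilon>"
    and "nonholonomic_impact_map A g V \<eta> h (q, v) = (q, \<delta>)" and "(q, \<delta>) \<in> distribution Q A \<eta>"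
proof -
  let ?T = "tangent_space A q"
  have q: "q \<in> topspace Q" and v: "v \<in> ?T" and \<eta>v: "\<And>k. \<eta> k q v = 0" and neg: "dh v < 0"
    using st by (auto simp: impact_states_def distribution_def tangent_bundle_def dh)
  have \<eta>c: "\<eta> k q \<in> cotangent_space A q" for k
    proof -
    have "q \<in> \<Union>(fst ` A)" using M q by (simp add: smooth_manifold_def)
    then show ?thesis using \<eta>[of k] unfolding smooth_one_form_def by blast
  qed
  have dhc: "dh \<in> cotangent_space A q"
    unfolding dh by (rule differential_in_cotangent_space[OF M h q])
  interpret inner_on ?T "g q" by (rule inner_on_tangent_space[OF M g q])
  have WT: "W k \<in> ?T" and FLW: "FL A g q (W k) = \<eta> k q" for k
    unfolding W dual_field_def by (rule FL_inv[OF M g q \<eta>c])+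
  have NT: "grad \<in> ?T" and FLN: "FL A g q grad = dh"
    unfolding grad gradient_def dh[symmetric] by (rule FL_inv[OF M g q dhc])+
  have gW: "\<eta> k q x = g q (W k) x" if "x \<in> ?T" for x k
    using fun_cong[OF FLW, of k x] that by (simp add: FL_def)
  have gN: "dh x = g q grad x" if "x \<in> ?T" for x
    using fun_cong[OF FLN, of x] that by (simp add: FL_def)
  have sumT: "(\<Sum>k\<in>UNIV. x k *\<^sub>R W k) \<in> ?T" for x using WT by (auto intro!: closed)
  \<comment> \<open>The right-hand side of the momentum condition is itself an \<open>FL\<close>
    image. Outside the tangent space both sides take the default value \<open>0\<close>.\<close>
  have FL_jump: "((\<Sum>k\<in>UNIV. x k *\<^sub>R \<eta> k q) + e *\<^sub>R dh) z =
      FL A g q ((\<Sum>k\<in>UNIV. x k *\<^sub>R W k) + e *\<^sub>R grad) z" (is "?F z = _") for x e z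
  proof -
    have F: "?F z = (\<Sum>k\<in>UNIV. x k * \<eta> k q z) + e * dh z"
      by (simp add: plus_fun_def scaleR_fun_def sum_fun_apply)
    show ?thesis
    proof (cases "z \<in> ?T")
      case True
      have "g q (\<Sum>k\<in>UNIV. x k *\<^sub>R W k) z = (\<Sum>k\<in>UNIV. x k * g q (W k) z)"
        using sum_right[of z UNIV W x, OF True WT] by (simp add: sym[OF sumT True] sym[OF WT True])
      then show ?thesis
        unfolding F using True sumT NT by (simp add: FL_def gW gN add_left scale_left closed)
    next
      case False
      then have "\<eta> k q z = 0" "dh z = 0" for k using \<eta>c dhc by (auto simp: cotangent_space_def)
      then show ?thesis unfolding F using False by (simp add: FL_def)
    qed
  qed
  have Mab: "m $ a $ b = g q (W a) (W b)" for a b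
    using gW[OF WT[of b], of a] by (simp add: m constraint_mass_def W)
  \<comment> \<open>A linear relation between the \<open>W k\<close> is carried by \<open>FL\<close>
    to the same relation between the constraint forms, by \<open>FL_jump\<close> with
    \<open>e = 0\<close>.\<close>
  show inv: "invertible m"
  proof (rule gram_invertible[OF WT Mab])
    fix x :: "'m \<Rightarrow> real" assume x: "(\<Sum>k\<in>UNIV. x k *\<^sub>R W k) = 0"
    have "(\<Sum>k\<in>UNIV. x k *\<^sub>R \<eta> k q) = 0"
    proof
      fix z
      show "(\<Sum>k\<in>UNIV. x k *\<^sub>R \<eta> k q) z = 0 z"
        using FL_jump[of x 0 z] x by (simp add: FL_def)
    qed
    then show "x = (\<lambda>_. 0)" using independent_family_zero[OF ind] by simp
  qed
  \<comment> \<open>Since \<open>dh\<close> is a covector outside the annihilator, some admissible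
    velocity \<open>u\<close> has \<open>dh u \<noteq> 0\<close>; this is the witness that
    \<open>N\<close> calls for.\<close>
  obtain u where u: "u \<in> ?T" "\<And>k. \<eta> k q u = 0" "dh u \<noteq> 0"
    using ann dhc q
    by (auto simp: annihilator_def cotangent_bundle_def distribution_def tangent_bundle_def dh)
  have u': "g q (W k) u = 0" "g q (W k) v = 0" "g q grad u \<noteq> 0" "g q grad v \<noteq> 0" for k
    using u \<eta>v neg v gW gN by auto
  \<comment> \<open>Inner products with \<open>grad\<close> are folded back into values of
    \<open>dh\<close>, so that the defining equations of \<open>den\<close>,
    \<open>\<epsilon>\<close> and \<open>\<Lambda>\<close> fit.\<close>
  note R = constrained_reflection[OF WT NT v Mab inv u(1) u'(1,3,2,4),
      of den \<epsilon> \<Lambda> \<delta>, folded gN[OF WT] gN[OF NT] gN[OF v], OF den \<epsilon> \<Lambda> \<delta>]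
  show "den \<noteq> 0" by (rule R)
  have mom: "FL A g q v' - FL A g q v = (\<Sum>k\<in>UNIV. l k *\<^sub>R \<eta> k q) + e *\<^sub>R dh \<longleftrightarrow>
      v' = v + (\<Sum>k\<in>UNIV. l k *\<^sub>R W k) + e *\<^sub>R grad" (is "?L \<longleftrightarrow> v' = v + ?s + ?n")
    if v': "v' \<in> ?T" for v' l e
  proof
    have sn: "?s + ?n \<in> ?T" by (intro closed WT NT)
    \<comment> \<open>Covectors are \<open>0\<close> off the tangent space, so their equality need
      only be tested on tangent vectors; nondegeneracy then recovers the velocity.\<close>
    have L: "?L \<longleftrightarrow> (\<forall>z\<in>?T. g q v' z - g q v z = g q (?s + ?n) z)"
      unfolding fun_eq_iff FL_jump by (auto simp: FL_def)
    show "v' = v + ?s + ?n" if ?L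
    proof -
      have "v' = v + (?s + ?n)"
      proof (rule eqI[OF v'])
        show "v + (?s + ?n) \<in> ?T" by (intro closed(2) v sn)
        show "g q v' z = g q (v + (?s + ?n)) z" if "z \<in> ?T" for z
          using bspec[OF L[THEN iffD1, OF \<open>?L\<close>] that] by (simp add: add_left[OF v sn that])
      qed
      then show ?thesis by (simp add: add.assoc)
    qed
    show ?L if "v' = v + ?s + ?n"
      using that v sn unfolding L by (simp add: add.assoc add_left[of v])
  qed
  have T': "v + (\<Sum>k\<in>UNIV. l k *\<^sub>R W k) + e *\<^sub>R grad \<in> ?T" for l e
    by (intro closed v WT NT)
  have cc: "corner_conditions A g V \<eta> h q v v' l e \<longleftrightarrow>
      v' = v + (\<Sum>k\<in>UNIV. l k *\<^sub>R W k) + e *\<^sub>R grad \<and> g q v' v' = g q v v \<and>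
        (\<forall>k. g q (W k) v' = 0)" for v' l e
  proof (cases "v' \<in> ?T")
    case True
    \<comment> \<open>Each side is minus the kinetic energy minus \<open>V q\<close>; the potential
      cancels because the base point does not move.\<close>
    have "natural_lagrangian g V (q, v') - FL A g q v' v' =
        natural_lagrangian g V (q, v) - FL A g q v v \<longleftrightarrow> g q v' v' = g q v v"
      using True v by (auto simp: natural_lagrangian_def FL_def)
    then show ?thesis
      using True gW[OF True] mom[OF True] by (simp add: corner_conditions_def dh)
  next
    case False
    then show ?thesis using T' by (auto simp: corner_conditions_def)
  qed
  have sol: "corner_conditions A g V \<eta> h q v v' l e \<and> e \<noteq> 0 \<longleftrightarrow>
      v' = \<delta> \<and> l = \<Lambda> \<and> e = \<epsilon>" for v' l e
    unfolding cc using R(2)[of v' l e] by blast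
  then show "corner_conditions A g V \<eta> h q v v' l e \<and> e \<noteq> 0 \<longleftrightarrow> v' = \<delta> \<and> l = \<Lambda> \<and> e = \<epsilon>" .
  \<comment> \<open>By \<open>sol\<close>, \<open>\<delta>\<close> is the only velocity admitting
    multipliers with \<open>e \<noteq> 0\<close>, so the description is well defined.\<close>
  have "(THE v'. \<exists>l e. e \<noteq> 0 \<and> corner_conditions A g V \<eta> h q v v' l e) = \<delta>"
    using sol by (intro the_equality) blast+
  then show "nonholonomic_impact_map A g V \<eta> h (q, v) = (q, \<delta>)"
    by (simp add: nonholonomic_impact_map_def)
  have "corner_conditions A g V \<eta> h q v \<delta> \<Lambda> \<epsilon>" using sol by blast
  then show "(q, \<delta>) \<in> distribution Q A \<eta>"
    using q by (simp add: corner_conditions_def distribution_def tangent_bundle_def)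
qed

theorem theorem3p2:
  fixes Q :: "'q topology"
    and A :: "('q, 'e::euclidean_space) chart set"
    and g :: "'q \<Rightarrow> ('q, 'e) tvec \<Rightarrow> ('q, 'e) tvec \<Rightarrow> real"
    and V h :: "'q \<Rightarrow> real"
    and \<eta> :: "'m::finite \<Rightarrow> 'q \<Rightarrow> ('q, 'e) covec"
  assumes "smooth_manifold Q A"
    and "riemannian_metric A g"
    and "smooth_fun A V"
    and "\<And>k. smooth_one_form A (\<eta> k)"
    and "\<And>q. q \<in> topspace Q \<Longrightarrow> inj (\<lambda>k. \<eta> k q) \<and> independent (range (\<lambda>k. \<eta> k q))"
    and "smooth_fun A h"
    and "\<And>q. q \<in> impact_surface Q h \<Longrightarrow> differential A h q \<noteq> 0"
    and "\<And>q. q \<in> impact_surface Q h \<Longrightarrow> (q, differential A h q) \<notin> annihilator Q A (distribution Q A \<eta>)"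
  shows "nonholonomic_impact_map A g V \<eta> h \<in> impact_states Q A \<eta> h \<rightarrow> distribution Q A \<eta> \<and>
    (\<forall>(q, v) \<in> impact_states Q A \<eta> h.
       let M = constraint_mass A g \<eta> q;
           dh = differential A h q;
           grad = gradient A g h q;
           W = (\<lambda>k. dual_field A g \<eta> k q);
           den = dh grad -
             (\<Sum>\<alpha>\<in>UNIV. \<Sum>\<beta>\<in>UNIV. matrix_inv M $ \<alpha> $ \<beta> * dh (W \<alpha>) * dh (W \<beta>));
           \<epsilon> = - 2 * dh v / den;
           \<Lambda> = (\<lambda>k. (\<Sum>l\<in>UNIV. 2 * matrix_inv M $ k $ l * dh (W l) * dh v) / den);
           \<delta> = v + (\<Sum>k\<in>UNIV. \<Lambda> k *\<^sub>R W k) + \<epsilon> *\<^sub>R grad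
       in invertible M \<and> den \<noteq> 0 \<and>
          (\<forall>v' l e. corner_conditions A g V \<eta> h q v v' l e \<and> e \<noteq> 0 \<longleftrightarrow>
             v' = \<delta> \<and> l = \<Lambda> \<and> e = \<epsilon>) \<and>
          nonholonomic_impact_map A g V \<eta> h (q, v) = (q, \<delta>))"
proof (intro conjI funcsetI ballI)
  fix x assume x: "x \<in> impact_states Q A \<eta> h"
  obtain q v where qv: "x = (q, v)" by (cases x)
  have q: "q \<in> topspace Q" "q \<in> impact_surface Q h"
    using x qv by (auto simp: impact_states_def distribution_def tangent_bundle_def impact_surface_def)
  \<comment> \<open>The \<open>refl\<close> facts instantiate the named quantities by the let-bound
    terms of the statement.\<close>
  note P = impact_at_point[OF assms(1,2,4) conjunct1[OF assms(5)[OF q(1)]]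
      conjunct2[OF assms(5)[OF q(1)]] assms(6) assms(8)[OF q(2)] x[unfolded qv]
      refl refl refl refl refl refl refl refl]
  show "nonholonomic_impact_map A g V \<eta> h x \<in> distribution Q A \<eta>"
    unfolding qv P(4) by (rule P(5))
  show "case x of (q, v) \<Rightarrow>
       let M = constraint_mass A g \<eta> q;
           dh = differential A h q;
           grad = gradient A g h q;
           W = (\<lambda>k. dual_field A g \<eta> k q);
           den = dh grad -
             (\<Sum>\<alpha>\<in>UNIV. \<Sum>\<beta>\<in>UNIV. matrix_inv M $ \<alpha> $ \<beta> * dh (W \<alpha>) * dh (W \<beta>));
           \<epsilon> = - 2 * dh v / den;
           \<Lambda> = (\<lambda>k. (\<Sum>l\<in>UNIV. 2 * matrix_inv M $ k $ l * dh (W l) * dh v) / den);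
           \<delta> = v + (\<Sum>k\<in>UNIV. \<Lambda> k *\<^sub>R W k) + \<epsilon> *\<^sub>R grad
       in invertible M \<and> den \<noteq> 0 \<and>
          (\<forall>v' l e. corner_conditions A g V \<eta> h q v v' l e \<and> e \<noteq> 0 \<longleftrightarrow>
             v' = \<delta> \<and> l = \<Lambda> \<and> e = \<epsilon>) \<and>
          nonholonomic_impact_map A g V \<eta> h (q, v) = (q, \<delta>)"
    unfolding qv Let_def prod.case by (intro conjI allI) (rule P)+
qed

end
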